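(* Let $r(2)=\limsup_{n\to\infty}\frac{\log_2 c(2,n)}{n}$, where $c(2,n)$ is the maximum size of a $2$-cancellative family of subsets of an $n$-element set. Then $r(2)>0.1170$.
   Context: A family of sets $\mathcal{F}$ is called $t$-cancellative if for all $t+2$ distinct members $A_1,\ldots,A_t,B,C\in\mathcal{F}$ we have $A_1\cup\cdots\cup A_t\cup B\neq A_1\cup\cdots\cup A_t\cup C$. $c(t,n)$ denotes the size of the largest $t$-cancellative family of subsets of an $n$-element set. *)

theory Defs
  imports Complex_Main "HOL-Library.Extended_Real"
begin

definition cancellative :: "nat \<Rightarrow> 'a set set \<Rightarrow> bool" where
  "cancellative t F \<longleftrightarrow>
     (\<forall>As B C. length As = t \<and> distinct (As @ [B, C]) \<and> set (As @ [B, C]) \<subseteq> F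
        \<longrightarrow> \<Union> (set As) \<union> B \<noteq> \<Union> (set As) \<union> C)"

definition max_cancellative :: "nat \<Rightarrow> nat \<Rightarrow> nat" where
  "max_cancellative t n = Max {card F | F :: nat set set. F \<subseteq> Pow {1..n} \<and> cancellative t F}"

(* The limit superior is taken in the extended reals, where it always exists.
   The junk value of the sequence at n = 0 does not affect it. *)
definition cancellative_rate :: "nat \<Rightarrow> ereal" where
  "cancellative_rate t =
     limsup (\<lambda>n. ereal (log 2 (real (max_cancellative t n)) / real n))"

end

theory Submission imports Defs "HOL-Library.FuncSet" begin

text \<open>
  The lower bound comes from a random code with expurgation.  The ground set is cut into
  \<open>N\<close> blocks of four points, and every member of the family contains exactly one point of
  each block, so that a member is a word of length \<open>N\<close> over an alphabet of four symbols.
  For four words with symbols \<open>a, a', b, c\<close> in some block, the two unions agree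
  on that block iff \<open>{a, a', b} = {a, a', c}\<close>; for independent uniform symbols this happens
  for 88 of the 256 quadruples (64 with \<open>b = c\<close>, and 24 with \<open>{b, c} = {a, a'}\<close> and
  \<open>b \<noteq> c\<close>), hence with probability \<open>11/32\<close>.  Among \<open>M\<close> random words the expected number of
  violating quadruples is at most \<open>M\<^sup>4 (11/32)\<^sup>N\<close>.  When this is at most \<open>M/2\<close>, deleting one
  word from each violating quadruple leaves a 2-cancellative family of at least \<open>M/2\<close> sets
  (lemma \<open>cancellative_family_exists\<close>).

  One point per block is better than including each point independently: the latter
  gives at best \<open>log 2 (128/101) / 3 < 0.114\<close>, while here the optimal \<open>M\<close> gives
  \<open>log 2 (32/11) / 12 > 0.128\<close>.  There is enough room to take \<open>N = 2 s\<close> and \<open>M = 2\<^sup>s\<close>, which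
  is permitted because \<open>8 < (32/11)\<^sup>2\<close> and gives the rate \<open>1/8\<close>.
\<close>

section \<open>The random code\<close>

lemma card_confused_symbols:
  defines "Q \<equiv> {(a, a', b, c). a < (4::nat) \<and> a' < 4 \<and> b < 4 \<and> c < 4 \<and> {a, a', b} = {a, a', c}}"
  shows "finite Q" "card Q \<le> 88"
proof -
  define A where "A = {..<4::nat}"
  define D where "D = A \<times> A - (\<lambda>b. (b, b)) ` A"
  define X where "X = (\<lambda>(a, a', b). (a, a', b, b)) ` (A \<times> A \<times> A)"
  define Y where "Y = (\<lambda>(b, c). (b, c, b, c)) ` D"
  define Z where "Z = (\<lambda>(b, c). (c, b, b, c)) ` D"
  have cover: "Q \<subseteq> X \<union> Y \<union> Z"
  proof
    fix q assume "q \<in> Q"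
    then obtain a a' b c where q: "q = (a, a', b, c)" "a \<in> A" "a' \<in> A" "b \<in> A" "c \<in> A"
      and eq: "{a, a', b} = {a, a', c}"
      unfolding Q_def A_def by auto
    have "b \<in> {a, a', c}" unfolding eq[symmetric] by simp
    moreover have "c \<in> {a, a', b}" unfolding eq by simp
    ultimately consider "b = c" | "b \<noteq> c" "a = b" "a' = c" | "b \<noteq> c" "a = c" "a' = b"
      by fastforce
    then show "q \<in> X \<union> Y \<union> Z"
    proof cases
      case 1
      with q have "q \<in> X" unfolding X_def by force
      then show ?thesis by simp
    next
      case 2
      with q have "q \<in> Y" unfolding Y_def D_def by force
      then show ?thesis by simp
    next
      case 3
      with q have "q \<in> Z" unfolding Z_def D_def by force
      then show ?thesis by simp
    qed
  qed
  have finA: "finite A" and cardA: "card A = 4"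
    by (simp_all add: A_def)
  have "card ((\<lambda>b. (b, b)) ` A) = 4"
    by (subst card_image) (simp_all add: inj_on_def cardA)
  moreover have "(\<lambda>b. (b, b)) ` A \<subseteq> A \<times> A"
    by auto
  ultimately have finD: "finite D" and cardD: "card D = 12"
    unfolding D_def using finA cardA by (simp_all add: card_Diff_subset card_cartesian_product)
  have fin: "finite X" "finite Y" "finite Z"
    unfolding X_def Y_def Z_def using finA finD by auto
  then show "finite Q"
    using cover by (meson finite_UnI finite_subset)
  have "card X \<le> card (A \<times> A \<times> A)"
    unfolding X_def by (intro card_image_le) (simp add: finA)
  then have "card X \<le> 64"
    by (simp add: card_cartesian_product cardA)
  moreover have "card Y \<le> 12" "card Z \<le> 12"
    unfolding Y_def Z_def cardD[symmetric] by (intro card_image_le finD)+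
  moreover have "card Q \<le> card (X \<union> Y \<union> Z)"
    using cover fin by (intro card_mono) auto
  moreover have "card (X \<union> Y \<union> Z) \<le> card (X \<union> Y) + card Z" "card (X \<union> Y) \<le> card X + card Y"
    by (rule card_Un_le)+
  ultimately show "card Q \<le> 88" by linarith
qed

text \<open>
  A column lists the symbols of all \<open>M\<close> words in one block.  Prescribing the symbols of four
  words leaves \<open>4 ^ (M - 4)\<close> columns, so the proportion of confused columns is that of the confused
  quadruples of symbols, \<open>88 / 4\<^sup>4 = 11 / 32\<close>.
\<close>

lemma card_confused_columns:
  fixes i j k l M :: nat
  assumes "distinct [i, j, k, l]" "i < M" "j < M" "k < M" "l < M"
  shows "real (card {c \<in> {..<M} \<rightarrow>\<^sub>E {..<4::nat}. {c i, c j, c k} = {c i, c j, c l}})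
           \<le> 11 / 32 * 4 ^ M"
proof -
  define Q where "Q = {(a, a', b, c). a < (4::nat) \<and> a' < 4 \<and> b < 4 \<and> c < 4 \<and> {a, a', b} = {a, a', c}}"
  define g where "g = (\<lambda>(a::nat, a'::nat, b::nat, c::nat) x.
     if x = i then {a} else if x = j then {a'} else if x = k then {b} else if x = l then {c} else {..<4})"
  have finQ: "finite Q" 
    unfolding Q_def by (rule card_confused_symbols)
  have I: "{i, j, k, l} \<subseteq> {..<M}" "card {i, j, k, l} = 4"
    using assms by auto
  have M4: "4 \<le> M"
    using card_mono[OF _ I(1)] I(2) by simp
  have cols: "card (Pi\<^sub>E {..<M} (g q)) = 4 ^ (M - 4)" for q
  proof -
    have "card (Pi\<^sub>E {..<M} (g q)) = (\<Prod>x<M. card (g q x))"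
      by (simp add: card_PiE)
    also have "\<dots> = (\<Prod>x\<in>{..<M} - {i, j, k, l}. card (g q x)) * (\<Prod>x\<in>{i, j, k, l}. card (g q x))"
      by (rule prod.subset_diff) (use I in auto)
    also have "(\<Prod>x\<in>{i, j, k, l}. card (g q x)) = 1"
      by (rule prod.neutral) (auto simp: g_def split: prod.splits)
    also have "(\<Prod>x\<in>{..<M} - {i, j, k, l}. card (g q x)) = (\<Prod>x\<in>{..<M} - {i, j, k, l}. 4)"
      by (rule prod.cong) (auto simp: g_def split: prod.splits)
    also have "\<dots> = 4 ^ (M - 4)"
      using I by (simp add: card_Diff_subset)
    finally show ?thesis by simp
  qed
  have "{c \<in> {..<M} \<rightarrow>\<^sub>E {..<4::nat}. {c i, c j, c k} = {c i, c j, c l}} \<subseteq> (\<Union>q\<in>Q. Pi\<^sub>E {..<M} (g q))"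
  proof
    fix c assume c: "c \<in> {c \<in> {..<M} \<rightarrow>\<^sub>E {..<4::nat}. {c i, c j, c k} = {c i, c j, c l}}"
    have "c x < 4" if "x < M" for x
      using c that by (auto simp: PiE_def Pi_def)
    then have "(c i, c j, c k, c l) \<in> Q"
      using c assms unfolding Q_def by blast
    moreover have "c \<in> Pi\<^sub>E {..<M} (g (c i, c j, c k, c l))"
      using c by (auto simp: PiE_def Pi_def g_def)
    ultimately show "c \<in> (\<Union>q\<in>Q. Pi\<^sub>E {..<M} (g q))" by blast
  qed
  then have "card {c \<in> {..<M} \<rightarrow>\<^sub>E {..<4::nat}. {c i, c j, c k} = {c i, c j, c l}}
      \<le> card (\<Union>q\<in>Q. Pi\<^sub>E {..<M} (g q))"
    by (intro card_mono finite_UN_I finQ finite_PiE) (auto simp: g_def split: prod.splits)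
  also have "\<dots> \<le> (\<Sum>q\<in>Q. card (Pi\<^sub>E {..<M} (g q)))"
    by (rule card_UN_le[OF finQ])
  also have "\<dots> = card Q * 4 ^ (M - 4)"
    by (simp add: cols)
  also have "\<dots> \<le> 88 * 4 ^ (M - 4)"
    unfolding Q_def by (intro mult_right_mono card_confused_symbols) simp
  finally have "real (card {c \<in> {..<M} \<rightarrow>\<^sub>E {..<4::nat}. {c i, c j, c k} = {c i, c j, c l}})
      \<le> real (88 * 4 ^ (M - 4))"
    by (simp only: of_nat_le_iff)
  also have "real (88 * 4 ^ (M - 4)) = 11 / 32 * 4 ^ M"
    using power_diff[of "4::real" 4 M] M4 by simp
  finally show ?thesis .
qed

text \<open>The first moment method: some outcome does at least as well as the average one.\<close>

lemma first_moment:
  fixes p :: real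
  assumes "finite \<Omega>" "\<Omega> \<noteq> {}" "finite T"
    and "\<And>t. t \<in> T \<Longrightarrow> real (card {\<omega> \<in> \<Omega>. P \<omega> t}) \<le> p * real (card \<Omega>)"
  obtains \<omega> where "\<omega> \<in> \<Omega>" "real (card {t \<in> T. P \<omega> t}) \<le> p * real (card T)"
proof (rule ccontr)
  assume "\<not> thesis"
  then have gt: "p * real (card T) < real (card {t \<in> T. P \<omega> t})" if "\<omega> \<in> \<Omega>" for \<omega>
    using that \<open>\<And>\<omega>. _ \<Longrightarrow> _ \<Longrightarrow> thesis\<close> by force
  have "real (card \<Omega>) * (p * real (card T)) = (\<Sum>\<omega>\<in>\<Omega>. p * real (card T))"
    by simp
  also have "\<dots> < (\<Sum>\<omega>\<in>\<Omega>. real (card {t \<in> T. P \<omega> t}))"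
    using assms gt by (intro sum_strict_mono) auto
  also have "\<dots> = (\<Sum>\<omega>\<in>\<Omega>. \<Sum>t | t \<in> T \<and> P \<omega> t. 1)"
    by simp
  also have "\<dots> = (\<Sum>t\<in>T. \<Sum>\<omega> | \<omega> \<in> \<Omega> \<and> P \<omega> t. 1)"
    by (rule sum.swap_restrict) (use assms in auto)
  also have "\<dots> \<le> (\<Sum>t\<in>T. p * real (card \<Omega>))"
    by (rule sum_mono) (use assms in auto)
  finally show False by (simp add: algebra_simps)
qed

text \<open>
  The code is given by its columns: \<open>f n x\<close> is the symbol of the word \<open>x\<close> in the block \<open>n\<close>.
  The columns are independent, so a fixed quadruple of words is confused in all \<open>N\<close> blocks with
  probability at most \<open>(11/32)\<^sup>N\<close>.
\<close>

lemma code_with_few_confusions: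
  fixes M N :: nat
  obtains f where
    "\<And>n x. n < N \<Longrightarrow> x < M \<Longrightarrow> f n x < (4::nat)"
    "real (card {(i, j, k, l). distinct [i, j, k, l] \<and> i < M \<and> j < M \<and> k < M \<and> l < M \<and>
        (\<forall>n<N. {f n i, f n j, f n k} = {f n i, f n j, f n l})}) \<le> (11 / 32) ^ N * real M ^ 4"
proof -
  define C where "C = {..<M} \<rightarrow>\<^sub>E {..<4::nat}"
  define \<Omega> where "\<Omega> = {..<N} \<rightarrow>\<^sub>E C"
  define T where "T = {(i, j, k, l). distinct [i, j, k, l] \<and> i < M \<and> j < M \<and> k < M \<and> l < M}"
  define P where "P = (\<lambda>f (i::nat, j::nat, k::nat, l::nat). \<forall>n<N. {f n i, f n j, f n k} = {f n i, f n j, f n l :: nat})"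
  have T: "T \<subseteq> {..<M} \<times> {..<M} \<times> {..<M} \<times> {..<M}"
    unfolding T_def by auto
  have finT: "finite T"
    by (rule finite_subset[OF T]) auto
  have cardT: "card T \<le> M ^ 4"
    using card_mono[OF _ T] by (simp add: card_cartesian_product power4_eq_xxxx mult.assoc)
  have finC: "finite C" and cardC: "card C = 4 ^ M" and C0: "C \<noteq> {}"
    by (auto simp: C_def card_PiE PiE_eq_empty_iff lessThan_empty_iff intro!: finite_PiE)
  have fin\<Omega>: "finite \<Omega>" and card\<Omega>: "card \<Omega> = (4 ^ M) ^ N" and \<Omega>0: "\<Omega> \<noteq> {}"
    using finC C0 by (auto simp: \<Omega>_def card_PiE cardC PiE_eq_empty_iff intro!: finite_PiE)
  have prob: "real (card {f \<in> \<Omega>. P f t}) \<le> (11 / 32) ^ N * real (card \<Omega>)" if "t \<in> T" for t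
  proof -
    obtain i j k l where t: "t = (i, j, k, l)" by (cases t)
    let ?B = "{c \<in> C. {c i, c j, c k} = {c i, c j, c l}}"
    have "{f \<in> \<Omega>. P f t} = {..<N} \<rightarrow>\<^sub>E ?B"
      unfolding \<Omega>_def P_def t by (auto simp: PiE_def Pi_def)
    then have "real (card {f \<in> \<Omega>. P f t}) = real (card ?B) ^ N"
      by (simp add: card_PiE)
    also have "\<dots> \<le> (11 / 32 * 4 ^ M) ^ N"
      using that unfolding t T_def C_def by (intro power_mono card_confused_columns) auto
    finally show ?thesis
      by (simp add: card\<Omega> power_mult_distrib power_divide)
  qed
  obtain f where f: "f \<in> \<Omega>" "real (card {t \<in> T. P f t}) \<le> (11 / 32) ^ N * real (card T)"
    using first_moment[where P = P, OF fin\<Omega> \<Omega>0 finT prob] by blast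
  show thesis
  proof (rule that[of f])
    show "f n x < 4" if "n < N" "x < M" for n x
      using f(1) that unfolding \<Omega>_def C_def by (auto simp: PiE_def Pi_def)
    have "real (card T) \<le> real M ^ 4"
      using cardT by (metis of_nat_le_iff of_nat_power)
    then have "(11 / 32) ^ N * real (card T) \<le> (11 / 32) ^ N * real M ^ 4"
      by (intro mult_left_mono) auto
    with f(2) have "real (card {t \<in> T. P f t}) \<le> (11 / 32) ^ N * real M ^ 4"
      by linarith
    moreover have "{t \<in> T. P f t} = {(i, j, k, l). distinct [i, j, k, l] \<and> i < M \<and> j < M \<and> k < M \<and>
        l < M \<and> (\<forall>n<N. {f n i, f n j, f n k} = {f n i, f n j, f n l})}"
      unfolding T_def P_def by auto
    ultimately show "real (card {(i, j, k, l). distinct [i, j, k, l] \<and> i < M \<and> j < M \<and> k < M \<and>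
        l < M \<and> (\<forall>n<N. {f n i, f n j, f n k} = {f n i, f n j, f n l})}) \<le> (11 / 32) ^ N * real M ^ 4"
      by (simp only:)
  qed
qed

section \<open>From words to sets\<close>

text \<open>The point \<open>4 n + u + 1\<close> stands for the symbol \<open>u\<close> in the block \<open>n\<close>.\<close>

definition word_set :: "nat \<Rightarrow> (nat \<Rightarrow> nat \<Rightarrow> nat) \<Rightarrow> nat \<Rightarrow> nat set" where
  "word_set N f x = (\<lambda>n. 4 * n + f n x + 1) ` {..<N}"

lemma word_set_subset:
  assumes "\<And>n. n < N \<Longrightarrow> f n x < 4"
  shows "word_set N f x \<subseteq> {1..4 * N}"
  using assms by (fastforce simp: word_set_def)

lemma mem_word_set_iff:
  assumes "\<And>n. n < N \<Longrightarrow> f n x < 4" "n < N" "u < 4"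
  shows "4 * n + u + 1 \<in> word_set N f x \<longleftrightarrow> f n x = u"
proof
  assume "4 * n + u + 1 \<in> word_set N f x"
  then obtain m where m: "m < N" "4 * n + u + 1 = 4 * m + f m x + 1"
    by (auto simp: word_set_def)
  with assms(1)[OF m(1)] assms(3) have "n = m" by linarith
  with m show "f n x = u" by simp
qed (use assms in \<open>auto simp: word_set_def\<close>)

lemma union_word_set_eq_imp:
  assumes f: "\<And>n x. n < N \<Longrightarrow> x \<in> {i, j, k, l} \<Longrightarrow> f n x < 4"
    and eq: "word_set N f i \<union> word_set N f j \<union> word_set N f k =
             word_set N f i \<union> word_set N f j \<union> word_set N f l"
    and n: "n < N"
  shows "{f n i, f n j, f n k} = {f n i, f n j, f n l}"
proof -
  have *: "u \<in> {f n i, f n j, f n k} \<longleftrightarrow> u \<in> {f n i, f n j, f n l}" if "u < 4" for u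
  proof -
    have "4 * n + u + 1 \<in> word_set N f x \<longleftrightarrow> u = f n x" if "x \<in> {i, j, k, l}" for x
      using mem_word_set_iff[of N f x n u] f[OF _ that] n \<open>u < 4\<close> by metis
    then show ?thesis using eq by blast
  qed
  have "f n i < 4" "f n j < 4" "f n k < 4" "f n l < 4"
    using f n by auto
  with *[of "f n k"] *[of "f n l"] show ?thesis by auto
qed

text \<open>
  Expurgation: one index of each confused quadruple is discarded.  The random words need not be
  distinct, but the surviving ones are, since two equal words would be confused in the presence
  of any two further words; this is where four survivors, hence \<open>M \<ge> 8\<close>, are required.
\<close>

lemma cancellative_family_exists:
  fixes M N :: nat
  assumes M: "8 \<le> M" and few: "(11 / 32) ^ N * real M ^ 4 \<le> real M / 2"
  obtains F where "F \<subseteq> Pow {1..4 * N}" "cancellative 2 F" "M \<le> 2 * card F"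
proof -
  obtain f where f: "\<And>n x. n < N \<Longrightarrow> x < M \<Longrightarrow> f n x < (4::nat)"
    and bound: "real (card {(i, j, k, l). distinct [i, j, k, l] \<and> i < M \<and> j < M \<and> k < M \<and> l < M \<and>
        (\<forall>n<N. {f n i, f n j, f n k} = {f n i, f n j, f n l})}) \<le> (11 / 32) ^ N * real M ^ 4"
    using code_with_few_confusions by blast
  define Q where "Q = {(i, j, k, l). distinct [i, j, k, l] \<and> i < M \<and> j < M \<and> k < M \<and> l < M \<and>
        (\<forall>n<N. {f n i, f n j, f n k} = {f n i, f n j, f n l})}"
  define S where "S = {..<M} - fst ` Q"
  let ?A = "word_set N f"
  have "Q \<subseteq> {..<M} \<times> {..<M} \<times> {..<M} \<times> {..<M}"
    unfolding Q_def by auto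
  then have finQ: "finite Q"
    by (rule finite_subset) auto
  have "2 * card Q \<le> M"
    using bound few unfolding Q_def by linarith
  moreover have "card (fst ` Q) \<le> card Q"
    by (rule card_image_le[OF finQ])
  moreover have "card {..<M} - card (fst ` Q) \<le> card S"
    unfolding S_def by (rule diff_card_le_card_Diff) (use finQ in auto)
  ultimately have cardS: "M \<le> 2 * card S" by simp
  have finS: "finite S" and SM: "\<And>x. x \<in> S \<Longrightarrow> x < M"
    unfolding S_def by auto
  have main: "?A i \<union> ?A j \<union> ?A k \<noteq> ?A i \<union> ?A j \<union> ?A l"
    if ijkl: "distinct [i, j, k, l]" "i \<in> S" "j \<in> S" "k \<in> S" "l \<in> S" for i j k l
  proof
    assume eq: "?A i \<union> ?A j \<union> ?A k = ?A i \<union> ?A j \<union> ?A l"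
    have "\<And>n x. n < N \<Longrightarrow> x \<in> {i, j, k, l} \<Longrightarrow> f n x < 4"
      using f SM ijkl by auto
    from union_word_set_eq_imp[OF this eq] have "(i, j, k, l) \<in> Q"
      unfolding Q_def using ijkl SM by auto
    then have "i \<in> fst ` Q" by force
    with ijkl show False unfolding S_def by blast
  qed
  have inj: "inj_on ?A S"
  proof (rule inj_onI, rule ccontr)
    fix k l assume kl: "k \<in> S" "l \<in> S" "?A k = ?A l" "k \<noteq> l"
    have "2 \<le> card (S - {k, l})"
      using cardS M kl finS by (simp add: card_Diff_subset)
    then obtain P where P: "P \<subseteq> S - {k, l}" "card P = 2"
      by (rule obtain_subset_with_card_n)
    then obtain i j where "P = {i, j}" "i \<noteq> j"
      by (auto simp: card_2_iff)
    with P have "i \<in> S - {k, l}" "j \<in> S - {k, l}" "i \<noteq> j"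
      by auto
    with main[of i j k l] kl show False by auto
  qed
  show thesis
  proof (rule that[of "?A ` S"])
    show "?A ` S \<subseteq> Pow {1..4 * N}"
      using word_set_subset[of N f] f SM by (meson PowI image_subsetI)
    show "M \<le> 2 * card (?A ` S)"
      using cardS by (simp add: card_image[OF inj])
    show "cancellative 2 (?A ` S)"
      unfolding cancellative_def
    proof (intro allI impI, elim conjE)
      fix As :: "nat set list" and B C
      assume *: "length As = 2" "distinct (As @ [B, C])" "set (As @ [B, C]) \<subseteq> ?A ` S"
      then obtain A A' where As: "As = [A, A']"
        by (auto simp: numeral_2_eq_2 length_Suc_conv)
      then obtain i j k l where "i \<in> S" "j \<in> S" "k \<in> S" "l \<in> S"
        "A = ?A i" "A' = ?A j" "B = ?A k" "C = ?A l"
        using *(3) by auto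
      with main[of i j k l] *(2) As show "\<Union> (set As) \<union> B \<noteq> \<Union> (set As) \<union> C"
        by auto
    qed
  qed
qed

section \<open>The rate\<close>

lemma card_le_max_cancellative:
  assumes "F \<subseteq> Pow {1..n}" "cancellative t F"
  shows "card F \<le> max_cancellative t n"
proof -
  have "{card F | F :: nat set set. F \<subseteq> Pow {1..n} \<and> cancellative t F} \<subseteq> card ` Pow (Pow {1..n})"
    by auto
  then have "finite {card F | F :: nat set set. F \<subseteq> Pow {1..n} \<and> cancellative t F}"
    by (rule finite_subset) auto
  then show ?thesis
    unfolding max_cancellative_def using assms by (intro Max_ge) auto
qed

text \<open>
  The words have length \<open>2 s\<close>.  The factor \<open>2\<close> lost to expurgation is absorbed by
  \<open>(32/11)\<^sup>2 = 8 * (128/121)\<close>, as \<open>(128/121)\<^sup>s \<ge> 1 + 7 s / 121 \<ge> 2\<close> for \<open>s \<ge> 18\<close>.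
\<close>

lemma max_cancellative_ge:
  assumes s: "18 \<le> s"
  shows "2 ^ (s - 1) \<le> max_cancellative 2 (8 * s)"
proof -
  have "2 \<le> 1 + real s * (7 / 121)"
    using s by simp
  also have "\<dots> \<le> (1 + 7 / 121) ^ s"
    by (rule Bernoulli_inequality) simp
  finally have "2 \<le> (128 / 121 :: real) ^ s" by simp
  then have "(121 / 128 :: real) ^ s \<le> 1 / 2"
    by (simp add: field_simps)
  moreover have "(11 / 32 :: real) ^ (2 * s) * real (2 ^ s) ^ 4 = (121 / 128) ^ s * 2 ^ s"
  proof -
    have "(11 / 32 :: real) ^ (2 * s) * real (2 ^ s) ^ 4 = ((11 / 32)\<^sup>2) ^ s * (2 ^ 4) ^ s"
      unfolding of_nat_power of_nat_numeral power_mult[symmetric] by (simp only: mult.commute)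
    also have "\<dots> = ((11 / 32)\<^sup>2 * 2 ^ 4) ^ s"
      by (simp only: power_mult_distrib)
    also have "(11 / 32 :: real)\<^sup>2 * 2 ^ 4 = 121 / 128 * 2"
      by (simp add: power2_eq_square)
    finally show ?thesis by (simp only: power_mult_distrib)
  qed
  ultimately have few: "(11 / 32) ^ (2 * s) * real (2 ^ s) ^ 4 \<le> real (2 ^ s) / 2"
    using mult_right_mono[of "(121 / 128 :: real) ^ s" "1 / 2" "2 ^ s"] by simp
  have "(2::nat) ^ 3 \<le> 2 ^ s"
    using s by (intro power_increasing) auto
  then have "8 \<le> (2::nat) ^ s" by simp
  from cancellative_family_exists[OF this few]
  obtain F where F: "F \<subseteq> Pow {1..4 * (2 * s)}" "cancellative 2 F" "2 ^ s \<le> 2 * card F" .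
  have "2 * 2 ^ (s - 1) = (2::nat) ^ s"
    using s by (simp flip: power_Suc)
  then have "2 ^ (s - 1) \<le> card F"
    using F(3) by linarith
  also have "\<dots> \<le> max_cancellative 2 (8 * s)"
    using card_le_max_cancellative[OF F(1,2)] by simp
  finally show ?thesis .
qed

theorem mainTheorem6: "cancellative_rate 2 > ereal 0.1170"
proof -
  let ?r = "\<lambda>n. ereal (log 2 (real (max_cancellative 2 n)) / real n)"
  \<comment> \<open>\<open>(s - 1) / (8 s) \<ge> 0.12\<close> holds exactly from \<open>s = 25\<close> on.\<close>
  have "ereal 0.12 \<le> ?r (8 * s)" if s: "25 \<le> s" for s
  proof -
    have "real (2 ^ (s - 1)) \<le> real (max_cancellative 2 (8 * s))"
      using max_cancellative_ge[of s] s by (simp only: of_nat_le_iff)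
    then have "log 2 (2 ^ (s - 1)) \<le> log 2 (real (max_cancellative 2 (8 * s)))"
      by (intro log_mono) auto
    then have "real s - 1 \<le> log 2 (real (max_cancellative 2 (8 * s)))"
      using s by (simp add: log_nat_power)
    then show ?thesis
      using s by (simp add: field_simps)
  qed
  then have "ereal 0.12 \<le> limsup (?r \<circ> (\<lambda>s. 8 * s))"
    by (intro le_Limsup) (auto simp: eventually_sequentially simp del: ereal_less_eq)
  also have "\<dots> \<le> limsup ?r"
    by (rule limsup_subseq_mono) (simp add: strict_mono_def)
  finally have "ereal 0.12 \<le> cancellative_rate 2"
    unfolding cancellative_rate_def .
  then show ?thesis
    by (rule less_le_trans[rotated]) simp
qed

end
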